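(* Let $g:\mathbb{R}\to\mathbb{R}$ be a derivator, $\mathbb{F}\in\{\mathbb{R},\mathbb{C}\}$, $\lambda\in\mathbb{F}\setminus\{0\}$, and fix $x_0\in\mathbb{R}$. Let $\Omega_{x_0}$ be the maximal interval on which the series $\sum_{n=0}^\infty\lambda^n\frac{g_{x_0,n}(x)}{n!}$ converges absolutely. If $\Delta g(x)<|\lambda|^{-1}$ for all $x<x_0$, then $\Omega_{x_0}=\mathbb{R}$.
   Context: A derivator is a left-continuous non-decreasing function $g:\mathbb{R}\to\mathbb{R}$; $\Delta g(x)=g(x^+)-g(x)$. $\mu_g$ denotes its Lebesgue–Stieltjes measure, characterized on Borel sets by $\mu_g([a,b))=g(b)-g(a)$ for $a<b$. $g$-monomials centered at $x_0$: $g_{x_0,0}\equiv 1$ and, for $n\ge 1$, $g_{x_0,n}(x)=n\int_{[x_0,x)}g_{x_0,n-1}\,d\mu_g$ if $x\ge x_0$ and $g_{x_0,n}(x)=-n\int_{[x,x_0)}g_{x_0,n-1}\,d\mu_g$ if $x<x_0$. *)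

theory Defs
  imports "HOL-Analysis.Analysis"
begin

definition derivator :: "(real \<Rightarrow> real) \<Rightarrow> bool" where
  "derivator g \<longleftrightarrow> mono g \<and> (\<forall>x. continuous (at_left x) g)"

definition jump :: "(real \<Rightarrow> real) \<Rightarrow> real \<Rightarrow> real" where
  "jump g x = Lim (at_right x) g - g x"

text \<open>The library's \<^const>\<open>interval_measure\<close> is built from right-continuous functions
  and half-open intervals \<open>{a<..b}\<close>. For left-continuous \<open>g\<close> the reflected function
  \<open>\<lambda>t. - g (- t)\<close> is right-continuous, and pushing its measure forward along
  \<open>t \<mapsto> - t\<close> gives the Borel measure with \<open>{a..<b} \<mapsto> g b - g a\<close>; this property and the
  uniqueness of the measure are proved below.\<close>

definition stieltjes_measure :: "(real \<Rightarrow> real) \<Rightarrow> real measure" where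
  "stieltjes_measure g = distr (interval_measure (\<lambda>t. - g (- t))) borel uminus"

fun g_monomial :: "(real \<Rightarrow> real) \<Rightarrow> real \<Rightarrow> nat \<Rightarrow> real \<Rightarrow> real" where
  "g_monomial g x0 0 x = 1"
| "g_monomial g x0 (Suc n) x =
     (if x0 \<le> x
      then real (Suc n) * (LINT y:{x0..<x}|stieltjes_measure g. g_monomial g x0 n y)
      else - real (Suc n) * (LINT y:{x..<x0}|stieltjes_measure g. g_monomial g x0 n y))"

text \<open>The scalar field is \<open>\<real>\<close> or \<open>\<complex>\<close>: both are instances of the two classes below, and by
  Gelfand--Mazur every instance is isometrically isomorphic to one of them. The monomials are
  real-valued and are embedded by \<^const>\<open>of_real\<close>.\<close>

definition g_exp_abs_conv ::
    "(real \<Rightarrow> real) \<Rightarrow> 'f::{real_normed_field,banach} \<Rightarrow> real \<Rightarrow> real \<Rightarrow> bool" where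
  "g_exp_abs_conv g l x0 x \<longleftrightarrow>
     summable (\<lambda>n. norm (l ^ n * (of_real (g_monomial g x0 n x) / fact n)))"

text \<open>The maximal interval of absolute convergence, as the union of all intervals around the
  centre \<open>x0\<close> (where the series is trivially convergent) on which the series converges
  absolutely. That it is itself the greatest such interval is proved below.\<close>

definition g_exp_domain ::
    "(real \<Rightarrow> real) \<Rightarrow> 'f::{real_normed_field,banach} \<Rightarrow> real \<Rightarrow> real set" where
  "g_exp_domain g l x0 =
     \<Union> {I. is_interval I \<and> x0 \<in> I \<and> (\<forall>x\<in>I. g_exp_abs_conv g l x0 x)}"

lemma sets_stieltjes_measure [simp, measurable_cong]:
  "sets (stieltjes_measure g) = sets borel"
  by (simp add: stieltjes_measure_def)

lemma emeasure_stieltjes_measure_Ico: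
  assumes "derivator g" "a \<le> b"
  shows "emeasure (stieltjes_measure g) {a..<b} = ennreal (g b - g a)"
proof -
  let ?F = "\<lambda>t. - g (- t)"
  have m: "?F x \<le> ?F y" if "x \<le> y" for x y
    using assms that by (auto simp: derivator_def mono_def)
  have c: "continuous (at_right x) ?F" for x
  proof -
    have "(g \<longlongrightarrow> g (- x)) (at_left (- x))"
      using assms by (simp add: derivator_def continuous_within)
    then have "((\<lambda>t. g (- t)) \<longlongrightarrow> g (- x)) (at_right x)"
      by (simp add: filterlim_at_left_to_right[of g])
    then show ?thesis
      by (auto simp: continuous_within intro: tendsto_minus)
  qed
  have "emeasure (stieltjes_measure g) {a..<b} =
      emeasure (interval_measure ?F) (uminus -` {a..<b})"
    by (simp add: stieltjes_measure_def emeasure_distr)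
  also have "uminus -` {a..<b} = {- b<..- a}"
    by auto
  also have "emeasure (interval_measure ?F) {- b<..- a} = ennreal (g b - g a)"
    using emeasure_interval_measure_Ioc[OF _ m c, of "- b" "- a"] assms(2) by simp
  finally show ?thesis .
qed

lemma stieltjes_measure_unique:
  assumes g: "derivator g" and s: "sets M = sets borel"
    and M: "\<And>a b. a < b \<Longrightarrow> emeasure M {a..<b} = ennreal (g b - g a)"
  shows "M = stieltjes_measure g"
proof (rule measure_eqI_generator_eq[where \<Omega> = UNIV
        and E = "range (\<lambda>(a, b). {a..<b::real})" and A = "\<lambda>n. {- real n..<real n}"])
  show "Int_stable (range (\<lambda>(a, b). {a..<b::real}))"
    by (auto simp: Int_stable_def)
  show "emeasure M X = emeasure (stieltjes_measure g) X"
    if X: "X \<in> range (\<lambda>(a, b). {a..<b::real})" for X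
  proof -
    obtain a b where X: "X = {a..<b}" using X by auto
    show ?thesis
      by (cases "a < b") (simp_all add: X M emeasure_stieltjes_measure_Ico[OF g])
  qed
  have "sets borel = sigma_sets UNIV (range (\<lambda>(a, b). {a..<b::real}))"
    by (subst borel_eq_atLeastLessThan) (rule sets_measure_of, simp)
  then show "sets M = sigma_sets UNIV (range (\<lambda>(a, b). {a..<b::real}))"
    and "sets (stieltjes_measure g) = sigma_sets UNIV (range (\<lambda>(a, b). {a..<b::real}))"
    by (simp_all add: s)
  show "(\<Union>n. {- real n..<real n}) = UNIV"
  proof (intro equalityI subset_UNIV subsetI)
    fix x :: real
    obtain n where "\<bar>x\<bar> < real n"
      using reals_Archimedean2 by blast
    then show "x \<in> (\<Union>n. {- real n..<real n})"
      by (auto intro!: exI[of _ n])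
  qed
  show "emeasure M {- real n..<real n} \<noteq> \<infinity>" for n
    by (cases "n = 0") (simp_all add: M)
qed auto

lemma g_exp_abs_conv_center: "g_exp_abs_conv g l x0 x0"
proof -
  have "g_monomial g x0 n x0 = 0" if "n \<notin> {0}" for n
    using that by (cases n) (auto simp: set_lebesgue_integral_def)
  then show ?thesis
    unfolding g_exp_abs_conv_def by (intro summable_finite[of "{0}"]) auto
qed

lemma g_exp_domain_greatest:
  shows "is_interval (g_exp_domain g l x0)"
    and "x0 \<in> g_exp_domain g l x0"
    and "x \<in> g_exp_domain g l x0 \<Longrightarrow> g_exp_abs_conv g l x0 x"
    and "\<lbrakk>is_interval I; x0 \<in> I; \<forall>x\<in>I. g_exp_abs_conv g l x0 x\<rbrakk> \<Longrightarrow> I \<subseteq> g_exp_domain g l x0"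
proof -
  show "is_interval (g_exp_domain g l x0)"
    unfolding g_exp_domain_def is_interval_connected_1
    by (rule connected_Union) auto
  have "is_interval {x0}"
    by (simp add: is_interval_connected_1)
  then show "x0 \<in> g_exp_domain g l x0"
    using g_exp_abs_conv_center unfolding g_exp_domain_def by blast
qed (auto simp: g_exp_domain_def)

end

theory Submission
  imports Defs
begin

text \<open>Put \<open>L = norm l\<close> and \<open>m n x = \<bar>g_monomial g x0 n x\<bar>\<close>. On either side of \<open>x0\<close> the
  functions \<open>m n\<close> grow with the distance from \<open>x0\<close>, so splitting the defining integral at a point
  \<open>x\<close> between \<open>x0\<close> and \<open>y\<close> bounds \<open>b n = L ^ n * m n y / fact n\<close> by the
  corresponding \<open>a n\<close> at \<open>x\<close>: \<open>b (n + 1) \<le> a (n + 1) + c * a n + q * b n\<close>, where \<open>q\<close> is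
  \<open>L\<close> times the mass of the part on which \<open>m n\<close> is estimated by \<open>m n y\<close>. If \<open>q < 1\<close>, summability
  passes from \<open>x\<close> to \<open>y\<close>. To the right of \<open>x0\<close> the atom at \<open>x\<close> contributes only to \<open>c\<close>, so
  \<open>q\<close> is locally small; to the left the atom at \<open>y\<close> enters \<open>q\<close>, and the hypothesis on the jumps
  is what makes \<open>q < 1\<close> locally. Compactness of intervals makes the local steps global.\<close>

section \<open>Summability from a linear recurrence\<close>

text \<open>Summing the recurrence bounds each partial sum S of \<open>b\<close> by C + q * S with C
  independent of the cutoff. As q < 1, this can be solved for S, and bounded partial sums of
  nonnegative terms suffice.\<close>

lemma summable_linear_recurrence:
  fixes a b :: "nat \<Rightarrow> real"
  assumes a: "summable a" "\<And>n. 0 \<le> a n" and b: "\<And>n. 0 \<le> b n"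
    and rec: "\<And>n. b (Suc n) \<le> a (Suc n) + c * a n + q * b n"
    and c: "0 \<le> c" and q: "0 \<le> q" "q < 1"
  shows "summable b"
proof (rule summableI_nonneg_bounded)
  define C where "C = b 0 + (1 + c) * suminf a"
  show "sum b {..<N} \<le> C / (1 - q)" for N
  proof -
    \<comment> \<open>Enlarging the cutoff before shifting the index makes the recurrence return the
      same sum \<open>sum b {..<N}\<close> on the right.\<close>
    have "sum b {..<N} \<le> sum b {..<Suc N}"
      using b by simp
    also have "\<dots> = b 0 + (\<Sum>n<N. b (Suc n))"
      by (rule sum.lessThan_Suc_shift)
    also have "(\<Sum>n<N. b (Suc n)) \<le> (\<Sum>n<N. a (Suc n) + c * a n + q * b n)"
      by (intro sum_mono rec)
    also have "\<dots> = (\<Sum>n<N. a (Suc n)) + c * sum a {..<N} + q * sum b {..<N}"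
      by (simp add: sum.distrib sum_distrib_left)
    also have "(\<Sum>n<N. a (Suc n)) \<le> sum a {..<Suc N}"
      unfolding sum.lessThan_Suc_shift using a by simp
    also have "\<dots> \<le> suminf a"
      using a by (intro sum_le_suminf) auto
    also have "c * sum a {..<N} \<le> c * suminf a"
      using a c by (intro mult_left_mono sum_le_suminf) auto
    finally have "sum b {..<N} \<le> C + q * sum b {..<N}"
      by (simp add: C_def algebra_simps)
    then show ?thesis
      using q by (simp add: field_simps)
  qed
qed (rule b)

section \<open>Integrals of monotone functions over bounded sets\<close>

lemma measure_stieltjes_measure_Ico:
  assumes "derivator g" "a \<le> b"
  shows "measure (stieltjes_measure g) {a..<b} = g b - g a"
  using assms by (simp add: measure_def emeasure_stieltjes_measure_Ico derivator_def mono_def)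

lemma emeasure_stieltjes_measure_finite:
  assumes "derivator g" "A \<subseteq> {a..<b}"
  shows "emeasure (stieltjes_measure g) A < \<infinity>"
proof (cases "a \<le> b")
  case True
  have "emeasure (stieltjes_measure g) A \<le> emeasure (stieltjes_measure g) {a..<b}"
    using assms by (intro emeasure_mono) auto
  also have "\<dots> < \<infinity>"
    using emeasure_stieltjes_measure_Ico[OF assms(1) True] by simp
  finally show ?thesis .
qed (use assms in auto)

text \<open>Monotonicity on the closed interval gives both Borel measurability and a bound by the
  endpoint values, and the mass of \<open>{a..<b}\<close> is finite. This is how the monomials are
  shown to be integrable.\<close>

lemma set_integrable_stieltjes_mono_on:
  fixes f :: "real \<Rightarrow> real"
  assumes g: "derivator g" and f: "mono_on {a..b} f" and A: "A \<in> sets borel" "A \<subseteq> {a..<b}"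
  shows "set_integrable (stieltjes_measure g) A f"
proof -
  have m: "set_borel_measurable (stieltjes_measure g) {a..b} f"
    using borel_measurable_mono_on_fnc[OF f]
    by (subst (asm) borel_measurable_restrict_space_iff)
       (simp_all add: set_borel_measurable_def cong: measurable_cong_sets)
  have "set_integrable (stieltjes_measure g) {a..<b} f"
    unfolding set_integrable_def
  proof (rule integrableI_bounded_set[where A = "{a..<b}" and B = "\<bar>f a\<bar> + \<bar>f b\<bar>"])
    show "(\<lambda>x. indicat_real {a..<b} x *\<^sub>R f x) \<in> borel_measurable (stieltjes_measure g)"
      using set_borel_measurable_subset[OF m, of "{a..<b}"]
      by (auto simp: set_borel_measurable_def atLeastLessThan_subseteq_atLeastAtMost_iff)
    show "emeasure (stieltjes_measure g) {a..<b} < \<infinity>"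
      by (rule emeasure_stieltjes_measure_finite[OF g order_refl])
    have "norm (f x) \<le> \<bar>f a\<bar> + \<bar>f b\<bar>" if "x \<in> {a..<b}" for x
      using mono_onD[OF f, of a x] mono_onD[OF f, of x b] that by auto
    then show "AE x\<in>{a..<b} in stieltjes_measure g.
        norm (indicat_real {a..<b} x *\<^sub>R f x) \<le> \<bar>f a\<bar> + \<bar>f b\<bar>"
      by simp
  qed auto
  then show ?thesis
    using A by (auto intro: set_integrable_subset)
qed

lemma set_integrable_stieltjes_antimono_on:
  fixes f :: "real \<Rightarrow> real"
  assumes g: "derivator g" and f: "antimono_on {a..b} f" and A: "A \<in> sets borel" "A \<subseteq> {a..<b}"
  shows "set_integrable (stieltjes_measure g) A f"
proof -
  have "mono_on {a..b} (\<lambda>x. - f x)"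
    using f by (auto simp: monotone_on_def)
  from set_integrable_stieltjes_mono_on[OF g this A] show ?thesis
    by (simp add: set_integrable_def)
qed

lemma set_integral_le_const:
  fixes f :: "'a \<Rightarrow> real"
  assumes "set_integrable M A f" "A \<in> sets M" "emeasure M A < \<infinity>"
    and "\<And>x. x \<in> A \<Longrightarrow> f x \<le> c"
  shows "(LINT x:A|M. f x) \<le> c * measure M A"
proof -
  have "(LINT x:A|M. f x) \<le> (LINT x:A|M. c)"
    using assms by (intro set_integral_mono) (auto simp: set_integrable_def)
  also have "\<dots> = c * measure M A"
    using assms by (simp add: set_integral_const)
  finally show ?thesis .
qed

lemma set_integral_nonneg:
  fixes f :: "'a \<Rightarrow> real"
  assumes "\<And>x. x \<in> A \<Longrightarrow> 0 \<le> f x"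
  shows "0 \<le> (LINT x:A|M. f x)"
  unfolding set_lebesgue_integral_def
  using assms by (intro Bochner_Integration.integral_nonneg) (auto simp: indicator_def)

lemma set_integral_mono_set:
  fixes f :: "'a \<Rightarrow> real"
  assumes "set_integrable M B f" "A \<in> sets M" "B \<in> sets M" "A \<subseteq> B"
    and "\<And>x. x \<in> B \<Longrightarrow> 0 \<le> f x"
  shows "(LINT x:A|M. f x) \<le> (LINT x:B|M. f x)"
proof -
  have "set_integrable M A f"
    using assms by (auto intro: set_integrable_subset)
  then show ?thesis
    using assms unfolding set_lebesgue_integral_def set_integrable_def
    by (intro Bochner_Integration.integral_mono) (auto simp: indicator_def)
qed

section \<open>Sign and monotonicity of the monomials\<close>

text \<open>The two claims go through the induction together: monotonicity of the previous monomial
  makes it integrable, and its nonnegativity makes the integral grow with its domain.\<close>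

lemma g_monomial_right:
  assumes g: "derivator g"
  shows "mono_on {x0..} (g_monomial g x0 n) \<and> (\<forall>x\<ge>x0. 0 \<le> g_monomial g x0 n x)"
proof (induction n)
  case 0
  then show ?case by (auto simp: monotone_on_def)
next
  case (Suc n)
  have i: "set_integrable (stieltjes_measure g) {x0..<y} (g_monomial g x0 n)" for y
    using Suc by (intro set_integrable_stieltjes_mono_on[OF g, of x0 y])
      (auto intro: mono_on_subset)
  have "(LINT t:{x0..<x}|stieltjes_measure g. g_monomial g x0 n t)
      \<le> (LINT t:{x0..<y}|stieltjes_measure g. g_monomial g x0 n t)" if "x \<le> y" for x y
    using Suc that by (intro set_integral_mono_set i) auto
  moreover have "0 \<le> (LINT t:{x0..<x}|stieltjes_measure g. g_monomial g x0 n t)" for x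
    using Suc by (intro set_integral_nonneg) auto
  ultimately show ?case
    by (auto simp: monotone_on_def intro!: mult_left_mono)
qed

lemma abs_g_monomial_right:
  assumes "derivator g" "x0 \<le> x"
  shows "\<bar>g_monomial g x0 n x\<bar> = g_monomial g x0 n x"
  using g_monomial_right[OF assms(1)] assms(2) by simp

text \<open>At \<open>x = x0\<close> the definition takes the other branch, but both integrals are
  then over the empty set. The left side can thus be treated on a closed half-line.\<close>

lemma g_monomial_Suc_left:
  assumes "x \<le> x0"
  shows "g_monomial g x0 (Suc n) x =
    - real (Suc n) * (LINT t:{x..<x0}|stieltjes_measure g. g_monomial g x0 n t)"
  using assms by (cases "x = x0") (auto simp: set_lebesgue_integral_def)

text \<open>Left of \<open>x0\<close> each integration flips the sign. The factor
  \<open>(-1) ^ n\<close> absorbs this, so that the induction runs as on the right with the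
  direction of monotonicity reversed.\<close>

lemma g_monomial_left:
  assumes g: "derivator g"
  shows "antimono_on {..x0} (\<lambda>x. (-1) ^ n * g_monomial g x0 n x) \<and>
    (\<forall>x\<le>x0. 0 \<le> (-1) ^ n * g_monomial g x0 n x)"
proof (induction n)
  case 0
  then show ?case by (auto simp: monotone_on_def)
next
  case (Suc n)
  define k where "k = (\<lambda>n x. (-1) ^ n * g_monomial g x0 n x)"
  have k: "antimono_on {..x0} (k n)" "\<And>x. x \<le> x0 \<Longrightarrow> 0 \<le> k n x"
    using Suc by (auto simp: k_def)
  have i: "set_integrable (stieltjes_measure g) {y..<x0} (k n)" for y
    using k by (intro set_integrable_stieltjes_antimono_on[OF g, of y x0])
      (auto intro: monotone_on_subset)
  have "(LINT t:{x..<x0}|stieltjes_measure g. k n t)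
      \<le> (LINT t:{y..<x0}|stieltjes_measure g. k n t)" if "y \<le> x" for x y
    using k that by (intro set_integral_mono_set i) auto
  moreover have "0 \<le> (LINT t:{x..<x0}|stieltjes_measure g. k n t)" for x
    using k by (intro set_integral_nonneg) auto
  moreover have "k (Suc n) x = real (Suc n) * (LINT t:{x..<x0}|stieltjes_measure g. k n t)"
    if "x \<le> x0" for x
    unfolding k_def g_monomial_Suc_left[OF that] by (simp del: of_nat_Suc)
  ultimately have "antimono_on {..x0} (k (Suc n)) \<and> (\<forall>x\<le>x0. 0 \<le> k (Suc n) x)"
    by (auto simp: monotone_on_def intro!: mult_left_mono)
  then show ?case
    unfolding k_def .
qed

lemma abs_g_monomial_left:
  assumes "derivator g" "x \<le> x0"
  shows "\<bar>g_monomial g x0 n x\<bar> = (-1) ^ n * g_monomial g x0 n x"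
proof -
  have "0 \<le> (-1) ^ n * g_monomial g x0 n x"
    using g_monomial_left[OF assms(1)] assms(2) by blast
  then show ?thesis
    by (cases "even n") auto
qed

section \<open>Comparing monomials at two points\<close>

text \<open>The atom at \<open>x\<close> is charged with the value at \<open>x\<close>, and only the
  open interval with the larger value at \<open>y\<close>. The mass of \<open>{x<..<y}\<close>
  becomes small as \<open>y\<close> decreases to \<open>x\<close>, even if \<open>g\<close> jumps at
  \<open>x\<close>.\<close>

lemma g_monomial_step_right:
  assumes g: "derivator g" and "x0 \<le> x" "x < y"
  shows "\<bar>g_monomial g x0 (Suc n) y\<bar> \<le> \<bar>g_monomial g x0 (Suc n) x\<bar> + real (Suc n) *
    (\<bar>g_monomial g x0 n x\<bar> * measure (stieltjes_measure g) {x} +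
     \<bar>g_monomial g x0 n y\<bar> * measure (stieltjes_measure g) {x<..<y})"
proof -
  let ?M = "stieltjes_measure g" and ?m = "g_monomial g x0 n"
  have mono: "mono_on {x0..} ?m"
    using g_monomial_right[OF g] by blast
  have i: "set_integrable ?M A ?m" if "A \<in> sets borel" "A \<subseteq> {x0..<y}" for A
    using mono that by (intro set_integrable_stieltjes_mono_on[OF g, of x0 y])
      (auto intro: mono_on_subset)
  have fin: "emeasure ?M A < \<infinity>" if "A \<subseteq> {x0..<y}" for A
    using emeasure_stieltjes_measure_finite[OF g that] .
  have "{x0..<y} = {x0..<x} \<union> ({x} \<union> {x<..<y})"
    using assms by auto
  then have "(LINT t:{x0..<y}|?M. ?m t) =
      (LINT t:{x0..<x}|?M. ?m t) + (LINT t:{x} \<union> {x<..<y}|?M. ?m t)"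
    using assms by (simp only:) (intro set_integral_Un i, auto)
  also have "(LINT t:{x} \<union> {x<..<y}|?M. ?m t) = (LINT t:{x}|?M. ?m t) + (LINT t:{x<..<y}|?M. ?m t)"
    using assms by (intro set_integral_Un i) auto
  also have "(LINT t:{x}|?M. ?m t) \<le> ?m x * measure ?M {x}"
    using assms by (intro set_integral_le_const i fin) auto
  also have "(LINT t:{x<..<y}|?M. ?m t) \<le> ?m y * measure ?M {x<..<y}"
    using assms by (intro set_integral_le_const i fin) (auto intro!: mono_onD[OF mono])
  finally have "(LINT t:{x0..<y}|?M. ?m t) \<le> (LINT t:{x0..<x}|?M. ?m t) +
      (?m x * measure ?M {x} + ?m y * measure ?M {x<..<y})"
    by simp
  from mult_left_mono[OF this, of "real (Suc n)"]
  have "g_monomial g x0 (Suc n) y \<le> g_monomial g x0 (Suc n) x +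
      real (Suc n) * (?m x * measure ?M {x} + ?m y * measure ?M {x<..<y})"
    using assms by (simp add: distrib_left del: of_nat_Suc)
  then show ?thesis
    using assms by (simp add: abs_g_monomial_right[OF g] del: of_nat_Suc g_monomial.simps)
qed

text \<open>On \<open>{y..<x}\<close> the absolute value of the monomial is largest at
  \<open>y\<close>, which belongs to this set. The atom at \<open>y\<close> is therefore charged
  with the value at \<open>y\<close>, and the whole increment \<open>g x - g y\<close> multiplies
  it.\<close>

lemma g_monomial_step_left:
  assumes g: "derivator g" and "y \<le> x" "x \<le> x0"
  shows "\<bar>g_monomial g x0 (Suc n) y\<bar> \<le> \<bar>g_monomial g x0 (Suc n) x\<bar> +
    real (Suc n) * (\<bar>g_monomial g x0 n y\<bar> * (g x - g y))"
proof -
  let ?M = "stieltjes_measure g"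
  define k where "k = (\<lambda>n x. (-1) ^ n * g_monomial g x0 n x)"
  have mono: "antimono_on {..x0} (k n)"
    using g_monomial_left[OF g] by (auto simp: k_def)
  have i: "set_integrable ?M A (k n)" if "A \<in> sets borel" "A \<subseteq> {y..<x0}" for A
    using mono that by (intro set_integrable_stieltjes_antimono_on[OF g, of y x0])
      (auto intro: monotone_on_subset)
  have "{y..<x0} = {x..<x0} \<union> {y..<x}"
    using assms by auto
  then have "(LINT t:{y..<x0}|?M. k n t) =
      (LINT t:{x..<x0}|?M. k n t) + (LINT t:{y..<x}|?M. k n t)"
    using assms by (simp only:) (intro set_integral_Un i, auto)
  also have "(LINT t:{y..<x}|?M. k n t) \<le> k n y * measure ?M {y..<x}"
    using assms by (intro set_integral_le_const i emeasure_stieltjes_measure_finite[OF g order_refl])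
      (auto intro!: monotone_onD[OF mono])
  also have "measure ?M {y..<x} = g x - g y"
    using assms by (intro measure_stieltjes_measure_Ico)
  finally have "(LINT t:{y..<x0}|?M. k n t) \<le>
      (LINT t:{x..<x0}|?M. k n t) + k n y * (g x - g y)"
    by simp
  from mult_left_mono[OF this, of "real (Suc n)"]
  have "real (Suc n) * (LINT t:{y..<x0}|?M. k n t) \<le>
      real (Suc n) * (LINT t:{x..<x0}|?M. k n t) + real (Suc n) * (k n y * (g x - g y))"
    by (simp add: distrib_left del: of_nat_Suc)
  moreover have "k (Suc n) z = real (Suc n) * (LINT t:{z..<x0}|?M. k n t)" if "z \<le> x0" for z
    unfolding k_def g_monomial_Suc_left[OF that] by (simp del: of_nat_Suc)
  moreover have "\<bar>g_monomial g x0 n z\<bar> = k n z" if "z \<le> x0" for n z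
    using abs_g_monomial_left[OF g that] by (simp add: k_def)
  ultimately show ?thesis
    using assms by (simp del: of_nat_Suc g_monomial.simps)
qed

section \<open>Passing absolute convergence between points\<close>

lemma g_exp_abs_conv_iff:
  "g_exp_abs_conv g l x0 x \<longleftrightarrow> summable (\<lambda>n. norm l ^ n * \<bar>g_monomial g x0 n x\<bar> / fact n)"
  by (simp add: g_exp_abs_conv_def norm_mult norm_divide norm_power)

text \<open>After scaling by \<open>norm l ^ Suc n / fact (Suc n)\<close>, the factor
  \<open>Suc n\<close> cancels against the factorial, which leaves the recurrence with coefficients
  \<open>norm l * c\<close> and \<open>norm l * q\<close>. Only the second has to be below
  1.\<close>

lemma g_exp_abs_conv_step:
  fixes l :: "'f::{real_normed_field,banach}"
  assumes x: "g_exp_abs_conv g l x0 x"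
    and step: "\<And>n. \<bar>g_monomial g x0 (Suc n) y\<bar> \<le> \<bar>g_monomial g x0 (Suc n) x\<bar> +
      real (Suc n) * (\<bar>g_monomial g x0 n x\<bar> * c + \<bar>g_monomial g x0 n y\<bar> * q)"
    and c: "0 \<le> c" and q: "0 \<le> q" "norm l * q < 1"
  shows "g_exp_abs_conv g l x0 y"
  unfolding g_exp_abs_conv_iff
proof (rule summable_linear_recurrence)
  let ?t = "\<lambda>n x. norm l ^ n * \<bar>g_monomial g x0 n x\<bar> / fact n"
  show "summable (\<lambda>n. ?t n x)"
    using x by (simp add: g_exp_abs_conv_iff)
  show "?t (Suc n) y \<le> ?t (Suc n) x + (norm l * c) * ?t n x + (norm l * q) * ?t n y" for n
  proof -
    have "?t (Suc n) y \<le> norm l ^ Suc n / fact (Suc n) * (\<bar>g_monomial g x0 (Suc n) x\<bar> +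
      real (Suc n) * (\<bar>g_monomial g x0 n x\<bar> * c + \<bar>g_monomial g x0 n y\<bar> * q))"
      using mult_left_mono[OF step[of n], of "norm l ^ Suc n / fact (Suc n)"]
      by (simp del: g_monomial.simps of_nat_Suc fact_Suc power_Suc)
    also have "\<dots> = ?t (Suc n) x + real (Suc n) * norm l ^ Suc n / fact (Suc n) *
        (\<bar>g_monomial g x0 n x\<bar> * c + \<bar>g_monomial g x0 n y\<bar> * q)"
      by (simp add: algebra_simps del: g_monomial.simps of_nat_Suc fact_Suc power_Suc)
    also have "real (Suc n) * norm l ^ Suc n / fact (Suc n) = norm l * norm l ^ n / fact n"
      by (simp del: of_nat_Suc)
    finally show ?thesis
      by (simp add: field_simps del: g_monomial.simps of_nat_Suc fact_Suc power_Suc)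
  qed
qed (use c q in auto)

lemma g_exp_abs_conv_step_right:
  fixes l :: "'f::{real_normed_field,banach}"
  assumes "derivator g" "x0 \<le> x" "x \<le> y" "g_exp_abs_conv g l x0 x"
    and "norm l * measure (stieltjes_measure g) {x<..<y} < 1"
  shows "g_exp_abs_conv g l x0 y"
proof (cases "x = y")
  case False
  then show ?thesis
    using assms by (intro g_exp_abs_conv_step[OF assms(4) g_monomial_step_right]) auto
qed (use assms in simp)

lemma g_exp_abs_conv_step_left:
  fixes l :: "'f::{real_normed_field,banach}"
  assumes "derivator g" "y \<le> x" "x \<le> x0" "g_exp_abs_conv g l x0 x"
    and "norm l * (g x - g y) < 1"
  shows "g_exp_abs_conv g l x0 y"
proof (rule g_exp_abs_conv_step[OF assms(4)])
  \<comment> \<open>On the left no mass is charged with the value at \<open>x\<close>, so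
    \<open>c\<close> is 0.\<close>
  show "\<bar>g_monomial g x0 (Suc n) y\<bar> \<le> \<bar>g_monomial g x0 (Suc n) x\<bar> +
      real (Suc n) * (\<bar>g_monomial g x0 n x\<bar> * 0 + \<bar>g_monomial g x0 n y\<bar> * (g x - g y))" for n
    using g_monomial_step_left[OF assms(1-3), of n] by (simp del: g_monomial.simps of_nat_Suc)
qed (use assms in \<open>auto simp: derivator_def mono_def\<close>)

section \<open>Small increments near a point\<close>

lemma derivator_left_increment_small:
  assumes g: "derivator g" and "0 < e"
  obtains d where "0 < d" "\<And>u. u \<le> x \<Longrightarrow> x - u < d \<Longrightarrow> g x - g u < e"
proof -
  have "(g \<longlongrightarrow> g x) (at_left x)"
    using g by (simp add: derivator_def continuous_within)
  then have "\<forall>\<^sub>F u in at_left x. g x - e < g u"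
    using \<open>0 < e\<close> by (intro order_tendstoD) auto
  then obtain b where b: "b < x" "\<And>u. b < u \<Longrightarrow> u < x \<Longrightarrow> g x - e < g u"
    by (auto simp: eventually_at_left_field)
  show thesis
  proof
    show "0 < x - b" using b by simp
    show "g x - g u < e" if "u \<le> x" "x - u < x - b" for u
      using b(2)[of u] that \<open>0 < e\<close> by (cases "u = x") auto
  qed
qed

text \<open>With the atom at \<open>x\<close> left out, the open intervals starting at
  \<open>x\<close> shrink to the empty set, and continuity from above applies whatever the jump at
  \<open>x\<close>.\<close>

lemma stieltjes_measure_Ioo_small:
  assumes g: "derivator g" and "0 < e"
  obtains d where "0 < d" "\<And>v. v - x < d \<Longrightarrow> measure (stieltjes_measure g) {x<..<v} < e"
proof -
  let ?A = "\<lambda>n. {x<..<x + 1 / real (Suc n)}"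
  have fin: "emeasure (stieltjes_measure g) {x<..<y} < \<infinity>" for y
    by (rule emeasure_stieltjes_measure_finite[OF g, of _ x y]) auto
  have "(\<lambda>n. measure (stieltjes_measure g) (?A n)) \<longlonglongrightarrow> measure (stieltjes_measure g) (\<Inter>n. ?A n)"
  proof (rule Lim_measure_decseq)
    show "decseq ?A"
    proof (rule decseq_SucI)
      show "?A (Suc n) \<le> ?A n" for n
        using divide_left_mono[of "real (Suc n)" "real (Suc (Suc n))" 1] by force
    qed
    show "emeasure (stieltjes_measure g) (?A n) \<noteq> \<infinity>" for n
      using fin[of "x + 1 / real (Suc n)"] by simp
  qed auto
  also have "(\<Inter>n. ?A n) = {}"
  proof -
    have "\<exists>n. t \<notin> ?A n" for t
    proof (cases "x < t")
      case True
      then obtain n where "inverse (real (Suc n)) < t - x"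
        using reals_Archimedean[of "t - x"] by auto
      then show ?thesis
        by (intro exI[of _ n]) (simp add: inverse_eq_divide)
    qed auto
    then show ?thesis by blast
  qed
  finally have "\<forall>\<^sub>F n in sequentially. measure (stieltjes_measure g) (?A n) < e"
    using \<open>0 < e\<close> by (intro order_tendstoD(2)) auto
  then obtain n where n: "measure (stieltjes_measure g) (?A n) < e"
    by (auto simp: eventually_sequentially)
  show thesis
  proof
    show "0 < 1 / real (Suc n)" by simp
    show "measure (stieltjes_measure g) {x<..<v} < e" if "v - x < 1 / real (Suc n)" for v
    proof -
      have "measure (stieltjes_measure g) {x<..<v} \<le> measure (stieltjes_measure g) (?A n)"
        using that fin[of "x + 1 / real (Suc n)"]
        by (intro measure_mono_fmeasurable) (auto simp: fmeasurable_def)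
      then show ?thesis using n by simp
    qed
  qed
qed

text \<open>\<^const>\<open>jump\<close> is defined through \<^const>\<open>Lim\<close>, which is meaningful only
  because a monotone function has one-sided limits.\<close>

lemma mono_tendsto_at_right:
  fixes g :: "real \<Rightarrow> real"
  assumes "mono g"
  shows "(g \<longlongrightarrow> Inf (g ` {x<..})) (at_right x)"
proof (rule order_tendstoI)
  have bdd: "bdd_below (g ` {x<..})"
    using assms by (intro bdd_belowI2[of _ "g x"]) (auto simp: mono_def)
  show "\<forall>\<^sub>F t in at_right x. a < g t" if "a < Inf (g ` {x<..})" for a
    using eventually_at_right_less[of x]
  proof eventually_elim
    case (elim t)
    then show ?case
      using cINF_lower[OF bdd, of t] that by simp
  qed
  show "\<forall>\<^sub>F t in at_right x. g t < a" if "Inf (g ` {x<..}) < a" for a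
  proof -
    have "{x<..} \<noteq> {}" by simp
    then have "\<exists>y\<in>{x<..}. g y < a"
      using that cINF_less_iff[OF _ bdd, of a] by simp
    then obtain y where "x < y" "g y < a"
      by auto
    then show ?thesis
      using assms unfolding eventually_at_right_field mono_def
      by (meson less_imp_le le_less_trans)
  qed
qed

text \<open>The increment \<open>g v - g x\<close> tends to \<open>jump g x\<close> as
  \<open>v\<close> decreases to \<open>x\<close>, so a strict bound on the jump passes to short
  increments.\<close>

lemma derivator_right_increment_less:
  assumes g: "derivator g" and "jump g x < e"
  obtains d where "0 < d" "\<And>v. x < v \<Longrightarrow> v - x < d \<Longrightarrow> g v - g x < e"
proof -
  have t: "(g \<longlongrightarrow> Inf (g ` {x<..})) (at_right x)"
    using g by (intro mono_tendsto_at_right) (simp add: derivator_def)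
  then have "Inf (g ` {x<..}) < g x + e"
    using assms tendsto_Lim[OF _ t] by (simp add: jump_def)
  from order_tendstoD(2)[OF t this] obtain b where
    b: "x < b" "\<And>v. x < v \<Longrightarrow> v < b \<Longrightarrow> g v < g x + e"
    by (auto simp: eventually_at_right_field)
  show thesis
    by (rule that[of "b - x"]) (use b in force)+
qed

section \<open>From local steps to the whole line\<close>

lemma g_exp_abs_conv_right:
  fixes l :: "'f::{real_normed_field,banach}"
  assumes g: "derivator g" and l: "l \<noteq> 0" and "x0 \<le> b"
  shows "g_exp_abs_conv g l x0 b"
proof -
  define e where "e = inverse (norm l)"
  have e: "0 < e" "\<And>q. q < e \<Longrightarrow> norm l * q < 1"
    using l by (auto simp: e_def field_simps)
  \<comment> \<open>As a relation between the endpoints \<open>z\<close> and \<open>b\<close> this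
    implication is transitive, so \<open>Bolzano\<close> reduces it to short intervals around each
    point.\<close>
  have "x0 \<le> z \<longrightarrow> g_exp_abs_conv g l x0 z \<longrightarrow> g_exp_abs_conv g l x0 b" if "z \<le> b" for z
    using that
  proof (induction rule: Bolzano)
    case (trans a b c)
    then show ?case by auto
  next
    case (local x)
    obtain d1 where d1: "0 < d1" "\<And>u. u \<le> x \<Longrightarrow> x - u < d1 \<Longrightarrow> g x - g u < e"
      using derivator_left_increment_small[OF g e(1)] by metis
    obtain d2 where d2: "0 < d2"
      "\<And>v. v - x < d2 \<Longrightarrow> measure (stieltjes_measure g) {x<..<v} < e"
      using stieltjes_measure_Ioo_small[OF g e(1)] by metis
    show ?case
    proof (intro exI[of _ "min d1 d2"] conjI allI impI)
      show "0 < min d1 d2" using d1 d2 by simp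
      fix u v
      assume uv: "u \<le> x \<and> x \<le> v \<and> v - u < min d1 d2" and "x0 \<le> u"
        and u: "g_exp_abs_conv g l x0 u"
      \<comment> \<open>An atom at \<open>x\<close> may be too heavy for a single step from
        \<open>u\<close> to \<open>v\<close>. Stopping at \<open>x\<close> keeps it out of both open
        intervals.\<close>
      have "measure (stieltjes_measure g) {u<..<x} \<le> measure (stieltjes_measure g) {u..<x}"
        using emeasure_stieltjes_measure_finite[OF g order_refl, of u x]
        by (intro measure_mono_fmeasurable) (auto simp: fmeasurable_def)
      also have "\<dots> < e"
        using uv d1(2)[of u] by (simp add: measure_stieltjes_measure_Ico[OF g])
      finally have "g_exp_abs_conv g l x0 x"
        using g_exp_abs_conv_step_right[OF g \<open>x0 \<le> u\<close> _ u] uv e(2) by auto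
      then show "g_exp_abs_conv g l x0 v"
        using g_exp_abs_conv_step_right[OF g, of x0 x v l] uv \<open>x0 \<le> u\<close> e(2) d2(2)[of v] by auto
    qed
  qed
  then show ?thesis
    using g_exp_abs_conv_center \<open>x0 \<le> b\<close> by blast
qed

lemma g_exp_abs_conv_left:
  fixes l :: "'f::{real_normed_field,banach}"
  assumes g: "derivator g" and l: "l \<noteq> 0" and "a \<le> x0"
    and jump: "\<And>x. x < x0 \<Longrightarrow> jump g x < inverse (norm l)"
  shows "g_exp_abs_conv g l x0 a"
proof -
  define e where "e = inverse (norm l)"
  have e: "0 < e" "\<And>q. q < e \<Longrightarrow> norm l * q < 1"
    using l by (auto simp: e_def field_simps)
  \<comment> \<open>The same scheme, with convergence now passing from the right endpoint to the
    left one.\<close>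
  have "z \<le> x0 \<longrightarrow> g_exp_abs_conv g l x0 z \<longrightarrow> g_exp_abs_conv g l x0 a" if "a \<le> z" for z
    using that
  proof (induction rule: Bolzano)
    case (trans a b c)
    then show ?case by auto
  next
    case (local x)
    obtain d1 where d1: "0 < d1" "\<And>u. u \<le> x \<Longrightarrow> x - u < d1 \<Longrightarrow> g x - g u < e"
      using derivator_left_increment_small[OF g e(1)] by metis
    obtain d2 where d2: "0 < d2"
      "\<And>v. x < v \<Longrightarrow> v \<le> x0 \<Longrightarrow> v - x < d2 \<Longrightarrow> g v - g x < e"
    proof (cases "x < x0")
      case True
      show ?thesis
        using derivator_right_increment_less[OF g jump[OF True]] that by (metis e_def)
    \<comment> \<open>For \<open>x0 \<le> x\<close> there is no \<open>v\<close> with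
      \<open>x < v \<le> x0\<close>, so any positive number serves.\<close>
    qed (use that[of 1] in auto)
    show ?case
    proof (intro exI[of _ "min d1 d2"] conjI allI impI)
      show "0 < min d1 d2" using d1 d2 by simp
      fix u v
      assume uv: "u \<le> x \<and> x \<le> v \<and> v - u < min d1 d2" and "v \<le> x0"
        and v: "g_exp_abs_conv g l x0 v"
      \<comment> \<open>The step from \<open>v\<close> to \<open>x\<close> carries the atom at
        \<open>x\<close> and is controlled by the jump bound; the step from \<open>x\<close> on to
        \<open>u\<close> is controlled by left-continuity at \<open>x\<close>.\<close>
      have "g v - g x < e"
        using uv d2(2)[of v] \<open>v \<le> x0\<close> e(1) by (cases "v = x") auto
      then have "g_exp_abs_conv g l x0 x"
        using g_exp_abs_conv_step_left[OF g _ \<open>v \<le> x0\<close> v] uv e(2) by auto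
      then show "g_exp_abs_conv g l x0 u"
        using g_exp_abs_conv_step_left[OF g, of u x x0 l] uv \<open>v \<le> x0\<close> e(2) d1(2)[of u] by auto
    qed
  qed
  then show ?thesis
    using g_exp_abs_conv_center \<open>a \<le> x0\<close> by blast
qed

theorem proposition5p3:
  fixes g :: "real \<Rightarrow> real" and l :: "'f::{real_normed_field,banach}" and x0 :: real
  assumes "derivator g"
    and "l \<noteq> 0"
    and "\<And>x. x < x0 \<Longrightarrow> jump g x < inverse (norm l)"
  shows "g_exp_domain g l x0 = UNIV"
proof -
  have "g_exp_abs_conv g l x0 x" for x
    using g_exp_abs_conv_left[OF assms(1,2), of x x0] assms(3)
      g_exp_abs_conv_right[OF assms(1,2), of x0 x] by (cases "x \<le> x0") auto
  then show ?thesis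
    using g_exp_domain_greatest(4)[of UNIV x0 g l] by auto
qed

end
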